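(* If $f\colon U\to\mathbb{C}^2$ is a proper holomorphic map, then for each open set $D\subset\mathbb{C}$ intersecting $T$ the polynomial hull of $f(U\cap D)$ equals $\mathbb{C}^2$ (and hence the closed convex hull of $f(U\cap D)$ also equals $\mathbb{C}^2$).
   Context: $U=\{|\zeta|<1\}$ is the open unit disc in $\mathbb{C}$ and $T=\{|\zeta|=1\}$. Proper means $|f(\zeta)|\to\infty$ as $|\zeta|\to1$. The polynomial hull $\widehat K$ of an arbitrary subset $K\subset\mathbb{C}^n$ is the intersection of all closed sets in $\mathbb{C}^n$ of the form $\{\operatorname{Re}P\le0\}$ containing $K$, where $P$ is a holomorphic polynomial on $\mathbb{C}^n$. *)

theory Defs
  imports "HOL-Complex_Analysis.Complex_Analysis"
begin

text \<open>Holomorphic polynomials on \<open>\<complex>\<^sup>n\<close>, as polynomial functions in multi-index form: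
  \<open>\<alpha> $ i\<close> is the exponent of the \<open>i\<close>-th coordinate.\<close>

definition holomorphic_polynomial :: "(complex ^ 'n \<Rightarrow> complex) \<Rightarrow> bool" where
  "holomorphic_polynomial P \<longleftrightarrow>
     (\<exists>(A :: (nat ^ 'n) set) c. finite A \<and>
        P = (\<lambda>z. \<Sum>\<alpha>\<in>A. c \<alpha> * (\<Prod>i\<in>UNIV. (z $ i) ^ (\<alpha> $ i))))"

text \<open>The set \<open>K\<close> is arbitrary, possibly unbounded: the hull is cut out by conditions
  \<open>Re P \<le> 0\<close> rather than by comparing \<open>norm (P z)\<close> with its supremum over \<open>K\<close>. The intersection
  of no sets is \<open>UNIV\<close>, but it never arises, as the zero polynomial always qualifies.\<close>

definition polynomial_hull :: "(complex ^ 'n) set \<Rightarrow> (complex ^ 'n) set" where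
  "polynomial_hull K =
     \<Inter>{{z. Re (P z) \<le> 0} | P. holomorphic_polynomial P \<and> K \<subseteq> {z. Re (P z) \<le> 0}}"

text \<open>Holomorphy of a map into \<open>\<complex>\<^sup>n\<close> is componentwise, since \<open>holomorphic_on\<close> only covers
  complex-valued functions.\<close>

definition holomorphic_map_on :: "(complex \<Rightarrow> complex ^ 'n) \<Rightarrow> complex set \<Rightarrow> bool" where
  "holomorphic_map_on f S \<longleftrightarrow> (\<forall>i. (\<lambda>\<zeta>. f \<zeta> $ i) holomorphic_on S)"

text \<open>\<open>norm (f \<zeta>) \<rightarrow> \<infinity>\<close> as \<open>norm \<zeta>\<close> tends to 1 from below; values of \<open>f\<close> outside the
  open unit disc are irrelevant.\<close>

definition proper_on_disc :: "(complex \<Rightarrow> complex ^ 'n) \<Rightarrow> bool" where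
  "proper_on_disc f \<longleftrightarrow>
     filterlim (\<lambda>\<zeta>. norm (f \<zeta>)) at_top (filtercomap norm (at_left (1 :: real)))"

end

theory Submission
  imports Defs
begin

text \<open>
  Why the theorem is true. Suppose that \<open>P\<close> is a nonconstant polynomial with \<open>Re P \<le> 0\<close> on
  \<open>f(U \<inter> D)\<close>, and put \<open>g = P \<circ> f\<close>. For all but finitely many slopes \<open>\<mu>\<close>, the polynomial \<open>P\<close> has full
  degree along the lines \<open>z\<^sub>2 - \<mu> z\<^sub>1 = const\<close>, and then \<open>(P, z\<^sub>2 - \<mu> z\<^sub>1)\<close> is a proper map of \<open>\<complex>\<^sup>2\<close>
  (\<open>nonconstant_polynomial_proper_with_linear\<close>). With \<open>u = f\<^sub>2 - \<mu> f\<^sub>1\<close>, the properness of \<open>f\<close> says that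
  wherever \<open>g\<close> stays bounded near the arc \<open>D \<inter> T\<close>, the function \<open>u\<close> tends to infinity. Classically one
  concludes with the theorems of Fatou and Lusin-Privalov: \<open>g\<close> takes values in a half plane, so it
  has finite nontangential limits almost everywhere on the arc, hence \<open>1/u\<close> has nontangential limit 0
  almost everywhere there, which is impossible.

  The proof below replaces boundary limits by an argument with the maximum principle alone
  (\<open>half_plane_valued_pair_not_proper_at_arc\<close>). The function \<open>v = ln \<bar>1 - g\<bar>\<close> is harmonic and nonnegative,
  because \<open>Re g \<le> 0\<close>. On a sublevel set \<open>v < A\<close>, the function \<open>ln \<bar>1/u\<bar>\<close> tends to \<open>-\<infinity>\<close> at the arc. The part of
  the boundary of the sublevel set that lies inside the disc has harmonic measure at most \<open>v/A < 1\<close>,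
  so the arc is seen with positive harmonic measure, and the two-constants theorem forces
  \<open>1/u = 0\<close>. Two more positive harmonic functions, the distance to the tangent of \<open>T\<close> at a
  point of the arc and a multiple of \<open>ln (1/\<bar>z\<bar>)\<close>, are added to \<open>v\<close>. They keep the region inside \<open>D\<close> and close
  to \<open>T\<close>, where \<open>\<bar>u\<bar> \<ge> 1\<close>. All three are logarithms of moduli of holomorphic functions, so the comparison is
  carried out with the ordinary maximum modulus principle.

  So only constant polynomials cut out the polynomial hull of \<open>f(U \<inter> D)\<close>. Real affine functions
  are real parts of polynomials of degree at most 1, so by separation the closed convex hull contains the polynomial
  hull.
\<close>

section \<open>A two-constants principle\<close>

text \<open>
  On the region where \<open>\<bar>E\<bar> > 1\<close>, the products \<open>E\<^sup>n \<Phi>\<close> are bounded by 1: at boundary points inside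
  \<open>S\<close> this holds because \<open>\<bar>E\<bar> = 1\<close> and \<open>\<bar>\<Phi>\<bar> \<le> 1\<close>, and at boundary points of \<open>S\<close> because \<open>\<Phi>\<close> tends to 0 while
  \<open>E\<^sup>n\<close> is bounded. Since \<open>n\<close> is arbitrary, \<open>\<Phi>\<close> vanishes. In terms of harmonic measure, \<open>ln \<bar>E\<bar>\<close>
  is a lower bound, up to a constant factor, for the harmonic measure of the part of the
  boundary where \<open>\<Phi>\<close> tends to 0.
\<close>
lemma maximum_principle_superlevel:
  fixes E \<Phi> :: "complex \<Rightarrow> complex"
  assumes "open S" "bounded S" and E: "E holomorphic_on S"
    and \<Phi>: "\<Phi> holomorphic_on {z \<in> S. cmod (E z) > 1}"
    and bdE: "\<And>z. z \<in> S \<Longrightarrow> cmod (E z) \<le> B"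
    and bd\<Phi>: "\<And>z. \<lbrakk>z \<in> S; cmod (E z) > 1\<rbrakk> \<Longrightarrow> cmod (\<Phi> z) \<le> 1"
    and lim: "\<And>p. p \<in> frontier S \<Longrightarrow> (\<Phi> \<longlongrightarrow> 0) (at p within {z \<in> S. cmod (E z) > 1})"
    and z0: "z0 \<in> S" "cmod (E z0) > 1"
  shows "\<Phi> z0 = 0"
proof -
  define \<Omega> where "\<Omega> = {z \<in> S. cmod (E z) > 1}"
  have contE: "continuous_on S E"
    using E by (rule holomorphic_on_imp_continuous_on)
  have "open (S \<inter> (\<lambda>z. cmod (E z)) -` {1<..})"
    using \<open>open S\<close> contE by (intro continuous_open_preimage continuous_intros) auto
  moreover have "\<Omega> = S \<inter> (\<lambda>z. cmod (E z)) -` {1<..}"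
    by (auto simp: \<Omega>_def)
  ultimately have "open \<Omega>" by simp
  have sub: "\<Omega> \<subseteq> S" by (auto simp: \<Omega>_def)
  have bound: "cmod (E z0) ^ n * cmod (\<Phi> z0) \<le> 1" for n
  proof (rule ccontr)
    define H where "H = (\<lambda>z. E z ^ n * \<Phi> z)"
    assume "\<not> ?thesis"
    then have "1 < cmod (H z0)"
      by (simp add: H_def norm_mult norm_power)
    then obtain c where c: "1 < c" "c < cmod (H z0)"
      using dense by blast
    have holH: "H holomorphic_on \<Omega>"
      unfolding H_def using E \<Phi> sub
      by (intro holomorphic_intros) (auto simp: \<Omega>_def intro: holomorphic_on_subset)
    then have contH: "continuous_on \<Omega> H"
      by (rule holomorphic_on_imp_continuous_on)
    \<comment> \<open>The threshold \<open>c > 1\<close> keeps this superlevel set away from the boundary of \<open>\<Omega>\<close>, so that it is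
      compact and \<open>\<bar>H\<bar> = c\<close> on its frontier.\<close>
    define K where "K = {z \<in> \<Omega>. c \<le> cmod (H z)}"
    have "B \<ge> 0"
      using bdE[OF z0(1)] norm_ge_zero order_trans by blast
    have "closed K"
      unfolding closed_sequential_limits
    proof (intro allI impI, elim conjE)
      fix x l assume xK: "\<forall>j. x j \<in> K" and xl: "x \<longlonglongrightarrow> l"
      have x\<Omega>: "x j \<in> \<Omega>" and xS: "x j \<in> S" and xE: "cmod (E (x j)) > 1"
        and xH: "c \<le> cmod (H (x j))" for j
        using xK by (auto simp: K_def \<Omega>_def)
      have "l \<in> closure S"
        using xS xl closure_sequential by blast
      have "l \<in> S"
      proof (rule ccontr)
        assume "l \<notin> S"
        with \<open>l \<in> closure S\<close> \<open>open S\<close> have "l \<in> frontier S"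
          by (simp add: frontier_def interior_open)
        have "filterlim x (at l within {z \<in> S. cmod (E z) > 1}) sequentially"
          using xl xS xE \<open>l \<notin> S\<close> by (auto simp: filterlim_at intro!: always_eventually)
        with lim[OF \<open>l \<in> frontier S\<close>] have "(\<lambda>j. \<Phi> (x j)) \<longlonglongrightarrow> 0"
          by (rule filterlim_compose)
        then have "(\<lambda>j. B ^ n * cmod (\<Phi> (x j))) \<longlonglongrightarrow> B ^ n * 0"
          by (intro tendsto_intros tendsto_norm_zero)
        moreover have "c \<le> B ^ n * cmod (\<Phi> (x j))" for j
        proof -
          have "c \<le> cmod (E (x j)) ^ n * cmod (\<Phi> (x j))"
            using xH[of j] by (simp add: H_def norm_mult norm_power)
          also have "\<dots> \<le> B ^ n * cmod (\<Phi> (x j))"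
            using bdE[OF xS] by (intro mult_right_mono power_mono) auto
          finally show ?thesis .
        qed
        ultimately have "c \<le> B ^ n * 0"
          by (intro LIMSEQ_le_const) auto
        with c show False by simp
      qed
      have "(\<lambda>j. E (x j)) \<longlonglongrightarrow> E l"
        using contE \<open>l \<in> S\<close> xS xl unfolding continuous_on_sequentially comp_def by blast
      then have "(\<lambda>j. cmod (E (x j)) ^ n) \<longlonglongrightarrow> cmod (E l) ^ n"
        by (intro tendsto_intros)
      moreover have "c \<le> cmod (E (x j)) ^ n" for j
      proof -
        have "c \<le> cmod (E (x j)) ^ n * cmod (\<Phi> (x j))"
          using xH[of j] by (simp add: H_def norm_mult norm_power)
        also have "\<dots> \<le> cmod (E (x j)) ^ n * 1"
          using bd\<Phi>[OF xS xE] by (intro mult_left_mono) auto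
        finally show ?thesis by simp
      qed
      ultimately have "c \<le> cmod (E l) ^ n"
        by (intro LIMSEQ_le_const) auto
      have "cmod (E l) > 1"
      proof (rule ccontr)
        assume "\<not> ?thesis"
        then have "cmod (E l) ^ n \<le> 1" by (simp add: power_le_one)
        with \<open>c \<le> cmod (E l) ^ n\<close> c show False by simp
      qed
      with \<open>l \<in> S\<close> have "l \<in> \<Omega>" by (simp add: \<Omega>_def)
      have "(\<lambda>j. H (x j)) \<longlonglongrightarrow> H l"
        using contH \<open>l \<in> \<Omega>\<close> x\<Omega> xl unfolding continuous_on_sequentially comp_def by blast
      then have "(\<lambda>j. cmod (H (x j))) \<longlonglongrightarrow> cmod (H l)"
        by (intro tendsto_intros)
      then have "c \<le> cmod (H l)"
        using xH by (intro LIMSEQ_le_const) auto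
      with \<open>l \<in> \<Omega>\<close> show "l \<in> K" by (simp add: K_def)
    qed
    have "K \<subseteq> \<Omega>" by (auto simp: K_def)
    have "cmod (H z0) \<le> c"
    proof (rule maximum_modulus_frontier[where S = K and f = H])
      show "H holomorphic_on interior K"
        using holH \<open>K \<subseteq> \<Omega>\<close> interior_subset by (blast intro: holomorphic_on_subset)
      show "continuous_on (closure K) H"
        using contH \<open>K \<subseteq> \<Omega>\<close> \<open>closed K\<close> continuous_on_subset by auto
      show "bounded K"
        using \<open>bounded S\<close> \<open>K \<subseteq> \<Omega>\<close> sub by (meson bounded_subset)
      show "z0 \<in> K"
        using z0 c by (simp add: K_def \<Omega>_def)
      fix z assume z: "z \<in> frontier K"
      then have "z \<in> K" using \<open>closed K\<close> by (simp add: frontier_def)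
      show "cmod (H z) \<le> c"
      proof (rule ccontr)
        assume gt: "\<not> cmod (H z) \<le> c"
        have "open (\<Omega> \<inter> (\<lambda>z. cmod (H z)) -` {c<..})"
          using \<open>open \<Omega>\<close> contH by (intro continuous_open_preimage continuous_intros) auto
        moreover have "z \<in> \<Omega> \<inter> (\<lambda>z. cmod (H z)) -` {c<..}"
          using gt \<open>z \<in> K\<close> by (auto simp: K_def)
        moreover have "\<Omega> \<inter> (\<lambda>z. cmod (H z)) -` {c<..} \<subseteq> K"
          by (auto simp: K_def)
        ultimately have "z \<in> interior K" by (meson interiorI)
        with z show False by (simp add: frontier_def)
      qed
    qed
    with c show False by simp
  qed
  show ?thesis
  proof (rule ccontr)
    assume "\<Phi> z0 \<noteq> 0"
    then obtain n where "1 / cmod (\<Phi> z0) < cmod (E z0) ^ n"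
      using real_arch_pow[OF z0(2)] by blast
    with \<open>\<Phi> z0 \<noteq> 0\<close> have "1 < cmod (E z0) ^ n * cmod (\<Phi> z0)"
      by (simp add: field_simps)
    with bound[of n] show False by simp
  qed
qed

section \<open>Localization to a circular segment of the disc\<close>

text \<open>
  For \<open>\<bar>p\<bar> = 1\<close>, the quantity \<open>Re (1 - cnj p * z)\<close> is the distance of \<open>z \<in> U\<close> to the tangent of the circle
  at \<open>p\<close>, a positive harmonic function that vanishes at \<open>p\<close>. A segment cut off by a chord is used in place of the lens
  \<open>U \<inter> ball p r\<close> because this function is constant on the chord.
\<close>
definition disc_cap :: "complex \<Rightarrow> real \<Rightarrow> complex set" where
  "disc_cap p c = {z. cmod z < 1 \<and> Re (1 - cnj p * z) < c}"

lemma open_disc_cap: "open (disc_cap p c)"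
  unfolding disc_cap_def
  by (intro open_Collect_conj open_Collect_less continuous_intros)

lemma disc_cap_subset_ball:
  assumes "cmod p = 1"
  shows "disc_cap p (r\<^sup>2 / 2) \<subseteq> ball 0 1 \<inter> ball p \<bar>r\<bar>"
proof
  fix z assume z: "z \<in> disc_cap p (r\<^sup>2 / 2)"
  have "(cmod (z - p))\<^sup>2 = (cmod z)\<^sup>2 + (cmod p)\<^sup>2 - 2 * Re (cnj p * z)"
    unfolding cmod_power2 by (simp add: power2_eq_square algebra_simps)
  also have "\<dots> < 1 + 1 - 2 * Re (cnj p * z)"
    using z assms by (auto simp: disc_cap_def power_less_one_iff abs_square_less_1)
  also have "\<dots> < r\<^sup>2"
    using z by (auto simp: disc_cap_def field_simps)
  finally have "cmod (z - p) < \<bar>r\<bar>"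
    by (simp add: power2_less_imp_less)
  then show "z \<in> ball 0 1 \<inter> ball p \<bar>r\<bar>"
    using z by (simp add: disc_cap_def dist_norm norm_minus_commute)
qed

text \<open>
  The two-constants principle, with the boundary behaviour of \<open>\<Phi>\<close> required only at the circular
  part of the boundary. The function \<open>E = M\<^sup>2 h exp (- L (1 - cnj p * z))\<close> takes care of the chord: the
  exponential factor is at most 1 and equals \<open>M powr (-4)\<close> in modulus on the chord, so the region \<open>\<bar>E\<bar> > 1\<close> does not
  reach the chord; but on the smaller cap it is at least \<open>1 / M\<close>, so there \<open>\<bar>E\<bar> \<ge> M \<bar>h\<bar>\<close>.
\<close>
lemma disc_cap_vanishing:
  assumes p: "cmod p = 1" and "c > 0" and M: "M > 1"
    and h: "h holomorphic_on disc_cap p c"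
    and h1: "\<And>z. z \<in> disc_cap p c \<Longrightarrow> cmod (h z) \<le> 1"
    and \<Phi>: "\<Phi> holomorphic_on {z \<in> disc_cap p c. M\<^sup>2 * cmod (h z) > 1}"
    and bd\<Phi>: "\<And>z. \<lbrakk>z \<in> disc_cap p c; M\<^sup>2 * cmod (h z) > 1\<rbrakk> \<Longrightarrow> cmod (\<Phi> z) \<le> 1"
    and lim: "\<And>e. e > 0 \<Longrightarrow> \<exists>\<rho><1. \<forall>z\<in>disc_cap p c.
                 cmod z > \<rho> \<longrightarrow> M\<^sup>2 * cmod (h z) > 1 \<longrightarrow> cmod (\<Phi> z) < e"
    and z0: "z0 \<in> disc_cap p (c / 4)" "M * cmod (h z0) > 1"
  shows "\<Phi> z0 = 0"
proof -
  let ?S = "disc_cap p c"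
  define L where "L = 4 * ln M / c"
  define E where "E = (\<lambda>z. of_real (M\<^sup>2) * h z * exp (- of_real L * (1 - cnj p * z)))"
  have "L > 0" using M \<open>c > 0\<close> by (simp add: L_def)
  have normE: "cmod (E z) = M\<^sup>2 * cmod (h z) * exp (- L * Re (1 - cnj p * z))" for z
    using M by (simp add: E_def norm_mult norm_power)
  have Re_pos: "Re (1 - cnj p * z) \<ge> 0" if "cmod z < 1" for z
  proof -
    have "Re (cnj p * z) \<le> cmod (cnj p * z)" by (rule complex_Re_le_cmod)
    also have "\<dots> \<le> 1" using that p by (simp add: norm_mult)
    finally show ?thesis by simp
  qed
  have E_le: "cmod (E z) \<le> M\<^sup>2 * cmod (h z)" if "z \<in> ?S" for z
  proof -
    have "exp (- L * Re (1 - cnj p * z)) \<le> 1"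
      using Re_pos[of z] that \<open>L > 0\<close> by (simp add: disc_cap_def mult_le_0_iff)
    then have "M\<^sup>2 * cmod (h z) * exp (- L * Re (1 - cnj p * z)) \<le> M\<^sup>2 * cmod (h z) * 1"
      by (intro mult_left_mono) auto
    then show ?thesis by (simp add: normE)
  qed
  have sub: "{z \<in> ?S. cmod (E z) > 1} \<subseteq> {z \<in> ?S. M\<^sup>2 * cmod (h z) > 1}"
    using E_le by force
  have z0S: "z0 \<in> ?S" using z0 \<open>c > 0\<close> by (auto simp: disc_cap_def)
  show ?thesis
  proof (rule maximum_principle_superlevel[where S = ?S and E = E and \<Phi> = \<Phi> and B = "M\<^sup>2"])
    show "open ?S" by (rule open_disc_cap)
    show "bounded ?S" by (rule bounded_subset[of "ball 0 1"]) (auto simp: disc_cap_def)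
    show "E holomorphic_on ?S"
      unfolding E_def by (intro holomorphic_intros h)
    show "\<Phi> holomorphic_on {z \<in> ?S. cmod (E z) > 1}"
      using \<Phi> sub by (rule holomorphic_on_subset)
    show "cmod (E z) \<le> M\<^sup>2" if "z \<in> ?S" for z
    proof -
      have "M\<^sup>2 * cmod (h z) \<le> M\<^sup>2 * 1" using h1[OF that] by (intro mult_left_mono) auto
      with E_le[OF that] show ?thesis by simp
    qed
    show "cmod (\<Phi> z) \<le> 1" if "z \<in> ?S" "cmod (E z) > 1" for z
      using bd\<Phi>[of z] sub that by blast
    show "z0 \<in> ?S" by fact
    show "cmod (E z0) > 1"
    proof -
      have "L * Re (1 - cnj p * z0) \<le> L * (c / 4)"
        using z0(1) \<open>L > 0\<close> by (intro mult_left_mono) (auto simp: disc_cap_def)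
      also have "\<dots> = ln M" using \<open>c > 0\<close> by (simp add: L_def)
      finally have "exp (- ln M) \<le> exp (- L * Re (1 - cnj p * z0))" by simp
      then have "inverse M \<le> exp (- L * Re (1 - cnj p * z0))"
        using M by (simp add: exp_minus)
      then have "M\<^sup>2 * cmod (h z0) * inverse M \<le> cmod (E z0)"
        unfolding normE by (intro mult_left_mono) auto
      moreover have "M\<^sup>2 * cmod (h z0) * inverse M = M * cmod (h z0)"
        using M by (simp add: power2_eq_square field_simps)
      ultimately show ?thesis using z0(2) by linarith
    qed
    fix q assume q: "q \<in> frontier ?S"
    have "q \<in> closure ?S" "q \<notin> ?S"
      using q open_disc_cap by (auto simp: frontier_def interior_open)
    have "closure ?S \<subseteq> {z. cmod z \<le> 1 \<and> Re (1 - cnj p * z) \<le> c}"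
      by (intro closure_minimal closed_Collect_conj closed_Collect_le continuous_intros)
         (auto simp: disc_cap_def)
    then have q1: "cmod q \<le> 1" and qc: "Re (1 - cnj p * q) \<le> c"
      using \<open>q \<in> closure ?S\<close> by auto
    show "(\<Phi> \<longlongrightarrow> 0) (at q within {z \<in> ?S. cmod (E z) > 1})"
    proof (cases "cmod q = 1")
      case True
      show ?thesis
      proof (rule tendstoI)
        fix e :: real assume "e > 0"
        then obtain \<rho> where \<rho>: "\<rho> < 1" "\<And>z. \<lbrakk>z \<in> ?S; cmod z > \<rho>; M\<^sup>2 * cmod (h z) > 1\<rbrakk> \<Longrightarrow> cmod (\<Phi> z) < e"
          using lim by meson
        have "\<forall>\<^sub>F z in at q within {z \<in> ?S. cmod (E z) > 1}. cmod z > \<rho>"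
          using True \<rho>(1) by (intro order_tendstoD(1)[where y = "cmod q"] tendsto_intros) auto
        moreover have "\<forall>\<^sub>F z in at q within {z \<in> ?S. cmod (E z) > 1}. z \<in> {z \<in> ?S. cmod (E z) > 1}"
          by (simp add: eventually_at_filter)
        ultimately show "\<forall>\<^sub>F z in at q within {z \<in> ?S. cmod (E z) > 1}. dist (\<Phi> z) 0 < e"
        proof eventually_elim
          case (elim z)
          then have "z \<in> ?S" "M\<^sup>2 * cmod (h z) > 1" using sub by blast+
          then show ?case using \<rho>(2) elim by simp
        qed
      qed
    next
      case False
      with q1 qc \<open>q \<notin> ?S\<close> have "Re (1 - cnj p * q) = c"
        by (auto simp: disc_cap_def)
      have "c / 2 < Re (1 - cnj p * q)"
        using \<open>c > 0\<close> \<open>Re (1 - cnj p * q) = c\<close> by simp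
      then have ev: "\<forall>\<^sub>F z in at q within {z \<in> ?S. cmod (E z) > 1}. c / 2 < Re (1 - cnj p * z)"
        by (intro order_tendstoD(1)[where y = "Re (1 - cnj p * q)"] tendsto_intros) 
      have "\<forall>\<^sub>F z in at q within {z \<in> ?S. cmod (E z) > 1}. z \<in> {z \<in> ?S. cmod (E z) > 1}"
        by (simp add: eventually_at_filter)
      with ev have "\<forall>\<^sub>F z in at q within {z \<in> ?S. cmod (E z) > 1}. False"
      proof eventually_elim
        case (elim z)
        have "2 * ln M = L * (c / 2)" using \<open>c > 0\<close> by (simp add: L_def)
        also have "\<dots> \<le> L * Re (1 - cnj p * z)"
          using elim \<open>L > 0\<close> by (intro mult_left_mono) auto
        finally have "exp (- L * Re (1 - cnj p * z)) \<le> exp (- (2 * ln M))" by simp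
        also have "\<dots> = inverse (M\<^sup>2)"
          using M by (simp add: exp_minus exp_double)
        finally have *: "exp (- L * Re (1 - cnj p * z)) \<le> inverse (M\<^sup>2)" .
        have "M\<^sup>2 * cmod (h z) * exp (- L * Re (1 - cnj p * z)) \<le> M\<^sup>2 * 1 * inverse (M\<^sup>2)"
          using * h1 elim by (intro mult_mono) auto
        also have "\<dots> = 1" using M by simp
        finally show ?case using elim by (simp add: normE)
      qed
      then show ?thesis by (simp add: trivial_limit_def[symmetric])
    qed
  qed
qed

section \<open>Half-plane valued functions near a boundary arc\<close>

text \<open>
  The vanishing lemma is used twice. Applied to \<open>1 / (1 - g)\<close>, it shows that \<open>\<bar>1 - g\<bar>\<close> does not tend to infinity
  at the arc, so there are points \<open>z\<^sub>0\<close> arbitrarily close to the circle with \<open>\<bar>1 - g z\<^sub>0\<bar>\<close> below a fixed bound \<open>K\<close>.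
  Applied to \<open>1 / u\<close> with \<open>h = z\<^sup>k / (1 - g)\<close>, it then gives the contradiction \<open>1 / u z\<^sub>0 = 0\<close>: where
  \<open>M\<^sup>2 \<bar>h\<bar> > 1\<close>, both \<open>\<bar>1 - g\<bar> < M\<^sup>2\<close> and \<open>\<bar>z\<bar>\<^sup>k > 1 / M\<^sup>2\<close>, and the latter confines the region, for large \<open>k\<close>,
  to an annulus on which properness forces \<open>\<bar>u\<bar> > 1\<close>. The order of choices matters: the annulus depends on \<open>K\<close>,
  and \<open>z\<^sub>0\<close> is chosen last, so close to the circle that \<open>\<bar>z\<^sub>0\<bar>\<^sup>k \<ge> 1/2\<close>.
\<close>
lemma half_plane_valued_pair_not_proper_at_arc:
  fixes u g :: "complex \<Rightarrow> complex"
  assumes "open D" and p: "p \<in> D" "cmod p = 1"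
    and u: "u holomorphic_on ball 0 1 \<inter> D" and g: "g holomorphic_on ball 0 1 \<inter> D"
    and Re_g: "\<And>z. z \<in> ball 0 1 \<inter> D \<Longrightarrow> Re (g z) \<le> 0"
    and proper: "\<And>K. \<exists>\<rho><1. \<forall>z\<in>ball 0 1 \<inter> D. cmod z > \<rho> \<longrightarrow> cmod (u z) > K \<or> cmod (g z) > K"
  shows False
proof -
  obtain r where r: "r > 0" "ball p r \<subseteq> D"
    using \<open>open D\<close> p(1) by (meson openE)
  define c where "c = (min r 1)\<^sup>2 / 2"
  have c: "0 < c" "c \<le> 1"
    using r(1) power_le_one[of "min r 1" 2] by (auto simp: c_def)
  have "disc_cap p c \<subseteq> ball 0 1 \<inter> ball p \<bar>min r 1\<bar>"
    unfolding c_def by (rule disc_cap_subset_ball[OF p(2)])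
  also have "\<dots> \<subseteq> ball 0 1 \<inter> D"
    using r by auto
  finally have capD: "disc_cap p c \<subseteq> ball 0 1 \<inter> D" .
  have cap4: "disc_cap p (c / 4) \<subseteq> disc_cap p c"
    using c by (auto simp: disc_cap_def)
  have norm_ge: "cmod (1 - g z) \<ge> 1" if "z \<in> disc_cap p c" for z
  proof -
    have "1 \<le> Re (1 - g z)" using Re_g that capD by fastforce
    then show ?thesis using complex_Re_le_cmod order_trans by blast
  qed
  then have nz: "1 - g z \<noteq> 0" if "z \<in> disc_cap p c" for z
    using that by fastforce
  have hol1: "(\<lambda>z. 1 / (1 - g z)) holomorphic_on disc_cap p c"
    using g capD nz by (intro holomorphic_intros) (auto intro: holomorphic_on_subset)
  have "\<exists>K. \<forall>\<rho><1. \<exists>z\<in>disc_cap p (c / 4). cmod z > \<rho> \<and> cmod (1 - g z) \<le> K"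
  proof (rule ccontr)
    assume "\<not> ?thesis"
    then have inf: "\<exists>\<rho><1. \<forall>z\<in>disc_cap p (c / 4). cmod z > \<rho> \<longrightarrow> cmod (1 - g z) > K" for K
      by (meson not_le)
    \<comment> \<open>This point has distance \<open>c / 32\<close> to the tangent at \<open>p\<close>, so it lies in the cap of height \<open>c / 16\<close>.\<close>
    define z0 where "z0 = of_real (1 - c / 32) * p"
    have "cmod z0 = 1 - c / 32"
      using c p(2) by (simp add: z0_def norm_mult flip: of_real_diff)
    moreover have "cnj p * z0 = of_real (1 - c / 32)"
      using complex_norm_square[of p] p(2) by (simp add: z0_def mult.commute mult.left_commute)
    then have "Re (1 - cnj p * z0) = c / 32"
      by (simp only: minus_complex.simps one_complex.simps Re_complex_of_real)
    ultimately have z0: "z0 \<in> disc_cap p (c / 4 / 4)"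
      using c by (simp add: disc_cap_def del: minus_complex.simps)
    have "1 / (1 - g z0) = 0"
    proof (rule disc_cap_vanishing[where p = p and c = "c / 4" and M = 2 and h = "\<lambda>_. 1"
          and \<Phi> = "\<lambda>z. 1 / (1 - g z)"])
      show "(\<lambda>z. 1 / (1 - g z)) holomorphic_on {z \<in> disc_cap p (c / 4). 2\<^sup>2 * cmod 1 > 1}"
        using hol1 cap4 by (auto intro: holomorphic_on_subset)
      show "cmod (1 / (1 - g z)) \<le> 1" if "z \<in> disc_cap p (c / 4)" for z
        using norm_ge[of z] that cap4 by (auto simp: norm_divide divide_le_eq_1)
      show "\<exists>\<rho><1. \<forall>z\<in>disc_cap p (c / 4). cmod z > \<rho> \<longrightarrow> 2\<^sup>2 * cmod 1 > 1
              \<longrightarrow> cmod (1 / (1 - g z)) < e" if "e > 0" for e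
      proof -
        obtain \<rho> where "\<rho> < 1" and
          \<rho>: "\<And>z. \<lbrakk>z \<in> disc_cap p (c / 4); cmod z > \<rho>\<rbrakk> \<Longrightarrow> cmod (1 - g z) > 1 / e"
          using inf by meson
        have "cmod (1 / (1 - g z)) < e" if "z \<in> disc_cap p (c / 4)" "cmod z > \<rho>" for z
        proof -
          have "cmod (1 - g z) \<ge> 1" using norm_ge that cap4 by blast
          then have "0 < cmod (1 - g z)" by linarith
          then show ?thesis using \<rho>[OF that] \<open>e > 0\<close> by (simp add: norm_divide field_simps)
        qed
        with \<open>\<rho> < 1\<close> show ?thesis by blast
      qed
    qed (use c p z0 in auto)
    moreover have "z0 \<in> disc_cap p c"
      using z0 c by (auto simp: disc_cap_def)
    ultimately show False using nz by auto
  qed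
  then obtain K where K: "\<And>\<rho>. \<rho> < 1 \<Longrightarrow> \<exists>z\<in>disc_cap p (c / 4). cmod z > \<rho> \<and> cmod (1 - g z) \<le> K"
    by meson
  have "K \<ge> 1"
    using K[of 0] norm_ge cap4 by fastforce
  \<comment> \<open>The factor 4 gives \<open>M \<bar>h z\<^sub>0\<bar> \<ge> 2\<close> once \<open>\<bar>1 - g z\<^sub>0\<bar> \<le> K\<close> and \<open>\<bar>z\<^sub>0\<bar>\<^sup>k \<ge> 1/2\<close>.\<close>
  define M where "M = 4 * K"
  have "M > 1" using \<open>K \<ge> 1\<close> by (simp add: M_def)
  have "M\<^sup>2 > 1" using \<open>M > 1\<close> by simp
  obtain \<rho>1 where \<rho>1: "\<rho>1 < 1"
    "\<And>z. \<lbrakk>z \<in> ball 0 1 \<inter> D; cmod z > \<rho>1\<rbrakk> \<Longrightarrow> cmod (u z) > M\<^sup>2 + 1 \<or> cmod (g z) > M\<^sup>2 + 1"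
    using proper by meson
  define \<rho> where "\<rho> = max \<rho>1 0"
  have \<rho>: "0 \<le> \<rho>" "\<rho> < 1" "\<rho>1 \<le> \<rho>" using \<rho>1 by (auto simp: \<rho>_def)
  have "1 / M\<^sup>2 > 0" using \<open>M > 1\<close> by simp
  then obtain k where k: "\<rho> ^ k < 1 / M\<^sup>2"
    using real_arch_pow_inv \<rho>(2) by blast
  have "1 / M\<^sup>2 < 1" using \<open>M\<^sup>2 > 1\<close> by (subst divide_less_eq_1) auto
  have "k \<noteq> 0"
  proof
    assume "k = 0"
    with k have "1 < 1 / M\<^sup>2" by simp
    with \<open>1 / M\<^sup>2 < 1\<close> show False by linarith
  qed
  define h where "h = (\<lambda>z. z ^ k * (1 / (1 - g z)))"
  have h1: "cmod (h z) \<le> cmod z ^ k" and h2: "cmod (h z) \<le> 1 / cmod (1 - g z)"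
    and h3: "cmod (h z) \<le> 1"
    if "z \<in> disc_cap p c" for z
  proof -
    have eq: "cmod (h z) = cmod z ^ k * (1 / cmod (1 - g z))"
      by (simp add: h_def norm_mult norm_power norm_divide)
    have le: "1 / cmod (1 - g z) \<le> 1" using norm_ge[OF that] by (auto simp: divide_le_eq_1)
    have "cmod z < 1" using that by (simp add: disc_cap_def)
    then have le': "cmod z ^ k \<le> 1" by (simp add: power_le_one)
    show "cmod (h z) \<le> cmod z ^ k"
      unfolding eq using le by (intro mult_left_le) auto
    with le' show "cmod (h z) \<le> 1" by simp
    show "cmod (h z) \<le> 1 / cmod (1 - g z)"
      unfolding eq using le' by (intro mult_left_le_one_le) auto
  qed
  have region: "cmod z > \<rho>" "cmod (g z) \<le> M\<^sup>2 + 1"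
    if "z \<in> disc_cap p c" "M\<^sup>2 * cmod (h z) > 1" for z
  proof -
    have lt: "1 / M\<^sup>2 < cmod (h z)"
      using that(2) \<open>M\<^sup>2 > 1\<close> by (subst pos_divide_less_eq) (auto simp: mult.commute)
    with h1[OF that(1)] k have "\<rho> ^ k < cmod z ^ k" by linarith
    then show "cmod z > \<rho>" by (rule power_less_imp_less_base) simp
    have "1 / M\<^sup>2 < 1 / cmod (1 - g z)" using lt h2[OF that(1)] by linarith
    moreover have "0 < cmod (1 - g z)" "0 < M\<^sup>2"
      using norm_ge[OF that(1)] \<open>M\<^sup>2 > 1\<close> by linarith+
    ultimately have "cmod (1 - g z) < M\<^sup>2"
      by (simp add: field_simps)
    moreover have "cmod (g z) \<le> cmod (1 - g z) + 1"
      using norm_triangle_ineq4[of 1 "1 - g z"] by simp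
    ultimately show "cmod (g z) \<le> M\<^sup>2 + 1" by linarith
  qed
  have u_gt: "cmod (u z) > 1" if "z \<in> disc_cap p c" "M\<^sup>2 * cmod (h z) > 1" for z
  proof -
    have "z \<in> ball 0 1 \<inter> D" "cmod z > \<rho>1"
      using that capD region(1)[OF that] \<rho>(3) by auto
    then show ?thesis using \<rho>1(2)[of z] region(2)[OF that] \<open>M\<^sup>2 > 1\<close> by auto
  qed
  \<comment> \<open>By Bernoulli's inequality, this radius satisfies \<open>\<sigma>\<^sup>k \<ge> 1/2\<close>.\<close>
  define \<sigma> where "\<sigma> = 1 - 1 / (2 * real k)"
  have \<sigma>: "0 \<le> \<sigma>" "\<sigma> < 1" using \<open>k \<noteq> 0\<close> by (auto simp: \<sigma>_def field_simps)
  obtain z0 where z0: "z0 \<in> disc_cap p (c / 4)" "cmod z0 > \<sigma>" "cmod (1 - g z0) \<le> K"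
    using K[OF \<sigma>(2)] by blast
  have z0c: "z0 \<in> disc_cap p c" using z0 cap4 by blast
  have "1 / 2 = 1 + real k * (- 1 / (2 * real k))" using \<open>k \<noteq> 0\<close> by (simp add: field_simps)
  also have "\<dots> \<le> (1 + (- 1 / (2 * real k))) ^ k"
    using \<sigma>(1) by (intro Bernoulli_inequality) (simp add: \<sigma>_def)
  also have "\<dots> = \<sigma> ^ k" by (simp add: \<sigma>_def)
  also have "\<dots> \<le> cmod z0 ^ k" using \<sigma>(1) z0(2) by (intro power_mono) auto
  finally have half: "1 / 2 \<le> cmod z0 ^ k" .
  have pos: "0 < K * cmod (1 - g z0)"
    using norm_ge[OF z0c] \<open>K \<ge> 1\<close> by (intro mult_pos_pos; linarith)
  have "1 < 4 * K * (1 / 2 * (1 / K))" using \<open>K \<ge> 1\<close> by simp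
  also have "\<dots> \<le> 4 * K * (cmod z0 ^ k * (1 / cmod (1 - g z0)))"
    using half z0(3) \<open>K \<ge> 1\<close> pos
    by (intro mult_left_mono mult_mono divide_left_mono) auto
  also have "\<dots> = M * cmod (h z0)"
    by (simp add: M_def h_def norm_mult norm_power norm_divide)
  finally have Mh: "1 < M * cmod (h z0)" .
  have "1 / u z0 = 0"
  proof (rule disc_cap_vanishing[where p = p and c = c and M = M and h = h
        and \<Phi> = "\<lambda>z. 1 / u z"])
    show "h holomorphic_on disc_cap p c"
      unfolding h_def by (rule holomorphic_on_mult[OF _ hol1]) (intro holomorphic_intros)
    show "(\<lambda>z. 1 / u z) holomorphic_on {z \<in> disc_cap p c. M\<^sup>2 * cmod (h z) > 1}"
    proof (intro holomorphic_intros)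
      show "u holomorphic_on {z \<in> disc_cap p c. M\<^sup>2 * cmod (h z) > 1}"
        using u capD by (auto intro: holomorphic_on_subset)
    qed (use u_gt in fastforce)
    show "cmod (1 / u z) \<le> 1" if "z \<in> disc_cap p c" "M\<^sup>2 * cmod (h z) > 1" for z
      using u_gt[OF that] by (auto simp: norm_divide divide_le_eq_1)
    show "\<exists>\<rho><1. \<forall>z\<in>disc_cap p c. cmod z > \<rho> \<longrightarrow> M\<^sup>2 * cmod (h z) > 1
            \<longrightarrow> cmod (1 / u z) < e" if "e > 0" for e
    proof -
      obtain \<rho>' where "\<rho>' < 1" and \<rho>': "\<And>z. \<lbrakk>z \<in> ball 0 1 \<inter> D; cmod z > \<rho>'\<rbrakk>
          \<Longrightarrow> cmod (u z) > max (1 / e) (M\<^sup>2 + 1) \<or> cmod (g z) > max (1 / e) (M\<^sup>2 + 1)"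
        using proper by meson
      have "cmod (1 / u z) < e"
        if "z \<in> disc_cap p c" "cmod z > \<rho>'" "M\<^sup>2 * cmod (h z) > 1" for z
      proof -
        have "cmod (u z) > 1 / e"
          using \<rho>'[of z] that capD region(2)[of z] by fastforce
        moreover have "0 < cmod (u z)"
          using u_gt[of z] that by linarith
        ultimately show ?thesis
          using \<open>e > 0\<close> by (simp add: norm_divide field_simps)
      qed
      with \<open>\<rho>' < 1\<close> show ?thesis by blast
    qed
    show "z0 \<in> disc_cap p (c / 4)" by fact
    show "M * cmod (h z0) > 1" by fact
  qed (use c p \<open>M > 1\<close> h3 in auto)
  moreover have "M\<^sup>2 * cmod (h z0) > 1"
  proof -
    have "1 * 1 < M * (M * cmod (h z0))"
      using \<open>M > 1\<close> Mh by (intro mult_strict_mono) auto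
    then show ?thesis by (simp add: power2_eq_square mult.assoc)
  qed
  ultimately show False using u_gt[OF z0c] by auto
qed

section \<open>Completing a polynomial to a proper map of the plane\<close>

text \<open>
  Let \<open>q\<close> be the top homogeneous part of \<open>P\<close>, of degree \<open>d > 0\<close>, evaluated at \<open>(1, x)\<close>, and choose \<open>\<mu>\<close> with
  \<open>q \<mu> \<noteq> 0\<close>. If \<open>z\<^sub>2 - \<mu> z\<^sub>1\<close> stays bounded along a sequence tending to infinity, then \<open>z\<^sub>1\<close> tends to
  infinity and \<open>z\<^sub>2 / z\<^sub>1\<close> tends to \<open>\<mu>\<close>, so that \<open>P z / z\<^sub>1\<^sup>d\<close> tends to \<open>q \<mu> \<noteq> 0\<close>; hence \<open>P z\<close> is unbounded.
\<close>
lemma nonconstant_polynomial_proper_with_linear: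
  fixes P :: "complex ^ 2 \<Rightarrow> complex"
  assumes "holomorphic_polynomial P" and nonconst: "\<And>a. P \<noteq> (\<lambda>_. a)"
  obtains \<mu> where "\<And>K. \<exists>R. \<forall>z. cmod (P z) \<le> K \<longrightarrow> cmod (z $ 2 - \<mu> * z $ 1) \<le> K \<longrightarrow> norm z \<le> R"
proof -
  obtain A0 :: "(nat ^ 2) set" and c where "finite A0"
    and P0: "P = (\<lambda>z. \<Sum>\<alpha>\<in>A0. c \<alpha> * (\<Prod>i\<in>UNIV. (z $ i) ^ (\<alpha> $ i)))"
    using assms(1) unfolding holomorphic_polynomial_def by blast
  \<comment> \<open>Zero coefficients must go, or \<open>d\<close> would not be the degree of \<open>P\<close>.\<close>
  define A where "A = {\<alpha> \<in> A0. c \<alpha> \<noteq> 0}"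
  have "finite A" using \<open>finite A0\<close> by (simp add: A_def)
  have P: "P z = (\<Sum>\<alpha>\<in>A. c \<alpha> * ((z $ 1) ^ (\<alpha> $ 1) * (z $ 2) ^ (\<alpha> $ 2)))" for z
    unfolding P0 A_def using \<open>finite A0\<close>
    by (intro sum.mono_neutral_cong_right) (auto simp: UNIV_2)
  define deg where "deg = (\<lambda>\<alpha> :: nat ^ 2. \<alpha> $ 1 + \<alpha> $ 2)"
  define d where "d = Max (deg ` A)"
  have "\<exists>\<alpha>\<in>A. deg \<alpha> > 0"
  proof (rule ccontr)
    assume "\<not> ?thesis"
    then have "P z = (\<Sum>\<alpha>\<in>A. c \<alpha>)" for z
      unfolding P by (intro sum.cong) (auto simp: deg_def)
    with nonconst show False by blast
  qed
  then obtain \<alpha>1 where \<alpha>1: "\<alpha>1 \<in> A" "deg \<alpha>1 > 0" by blast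
  have deg_le: "deg \<alpha> \<le> d" if "\<alpha> \<in> A" for \<alpha>
    unfolding d_def using that \<open>finite A\<close> by simp
  have "d > 0" using deg_le[OF \<alpha>1(1)] \<alpha>1(2) by simp
  have "d \<in> deg ` A"
    unfolding d_def using \<open>finite A\<close> \<alpha>1 by (intro Max_in) auto
  then obtain \<alpha>m where \<alpha>m: "\<alpha>m \<in> A" "deg \<alpha>m = d" by auto
  define q where "q = (\<Sum>\<alpha> | \<alpha> \<in> A \<and> deg \<alpha> = d. monom (c \<alpha>) (\<alpha> $ 2))"
  have "coeff q (\<alpha>m $ 2) = (\<Sum>\<alpha> | \<alpha> \<in> A \<and> deg \<alpha> = d. if \<alpha> = \<alpha>m then c \<alpha> else 0)"
    unfolding q_def coeff_sum
  proof (intro sum.cong refl)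
    fix \<alpha> assume "\<alpha> \<in> {\<alpha> \<in> A. deg \<alpha> = d}"
    \<comment> \<open>Within a fixed degree, the second exponent determines the monomial, so no terms of \<open>q\<close> cancel.\<close>
    then have "\<alpha> $ 2 = \<alpha>m $ 2 \<longleftrightarrow> \<alpha> = \<alpha>m"
      using \<alpha>m by (auto simp: vec_eq_iff forall_2 deg_def)
    then show "coeff (monom (c \<alpha>) (\<alpha> $ 2)) (\<alpha>m $ 2) = (if \<alpha> = \<alpha>m then c \<alpha> else 0)"
      by auto
  qed
  also have "\<dots> = c \<alpha>m"
    using \<alpha>m \<open>finite A\<close> by (simp add: sum.delta)
  finally have "coeff q (\<alpha>m $ 2) \<noteq> 0" using \<alpha>m by (simp add: A_def)
  then have "q \<noteq> 0" by auto
  then have "finite {x. poly q x = 0}" by (rule poly_roots_finite)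
  then obtain \<mu> where \<mu>: "poly q \<mu> \<noteq> 0"
    using infinite_UNIV_char_0[where 'a = complex] ex_new_if_finite by fastforce
  have "\<exists>R. \<forall>z. cmod (P z) \<le> K \<longrightarrow> cmod (z $ 2 - \<mu> * z $ 1) \<le> K \<longrightarrow> norm z \<le> R" for K
  proof (rule ccontr)
    assume "\<not> ?thesis"
    then have "\<forall>n::nat. \<exists>z :: complex ^ 2. cmod (P z) \<le> K \<and> cmod (z $ 2 - \<mu> * z $ 1) \<le> K \<and> norm z > real n"
      by (meson not_le)
    then obtain x :: "nat \<Rightarrow> complex ^ 2" where xP: "\<And>n. cmod (P (x n)) \<le> K"
      and xl: "\<And>n. cmod (x n $ 2 - \<mu> * x n $ 1) \<le> K" and xn: "\<And>n. norm (x n) > real n"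
      by metis
    define s where "s = (\<lambda>n. x n $ 1)"
    define t where "t = (\<lambda>n. x n $ 2 - \<mu> * x n $ 1)"
    have x2: "x n $ 2 = \<mu> * s n + t n" for n by (simp add: s_def t_def)
    have lower: "real n - K \<le> (1 + cmod \<mu>) * cmod (s n)" for n
    proof -
      have "real n < norm (x n)" by (rule xn)
      also have "\<dots> \<le> (\<Sum>i\<in>UNIV. norm (x n $ i))" unfolding norm_vec_def by (rule L2_set_le_sum) simp
      also have "\<dots> = cmod (s n) + cmod (\<mu> * s n + t n)" by (simp add: UNIV_2 s_def t_def)
      also have "\<dots> \<le> cmod (s n) + (cmod \<mu> * cmod (s n) + K)"
        using norm_triangle_ineq[of "\<mu> * s n" "t n"] xl[of n] by (simp add: norm_mult t_def)
      finally show ?thesis by (simp add: algebra_simps)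
    qed
    have "filterlim (\<lambda>n. (real n - K) / (1 + cmod \<mu>)) at_top sequentially"
    proof -
      have "filterlim (\<lambda>n. - K + real n) at_top sequentially"
        by (intro filterlim_tendsto_add_at_top[OF tendsto_const] filterlim_real_sequentially)
      then have "filterlim (\<lambda>n. inverse (1 + cmod \<mu>) * (- K + real n)) at_top sequentially"
        by (intro filterlim_tendsto_pos_mult_at_top[OF tendsto_const]) (auto simp: add_pos_nonneg)
      then show ?thesis by (simp add: field_simps)
    qed
    then have "filterlim (\<lambda>n. cmod (s n)) at_top sequentially"
    proof (rule filterlim_at_top_mono)
      show "\<forall>\<^sub>F n in sequentially. (real n - K) / (1 + cmod \<mu>) \<le> cmod (s n)"
        using lower by (intro always_eventually allI)
          (simp add: pos_divide_le_eq add_pos_nonneg mult.commute)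
    qed
    then have s_inf: "filterlim s at_infinity sequentially"
      by (rule filterlim_norm_at_top_imp_at_infinity)
    then have inv0: "(\<lambda>n. inverse (s n)) \<longlonglongrightarrow> 0"
      by (rule filterlim_compose[OF tendsto_inverse_0])
    have t0: "(\<lambda>n. t n * inverse (s n)) \<longlonglongrightarrow> 0"
      using xl inv0 by (intro lim_null_mult_left_bounded[where B = K]) (auto simp: t_def)
    have p0: "(\<lambda>n. P (x n) * inverse (s n) ^ d) \<longlonglongrightarrow> 0"
    proof -
      have "(\<lambda>n. inverse (s n) ^ d) \<longlonglongrightarrow> 0 ^ d"
        by (intro tendsto_intros inv0)
      then have "(\<lambda>n. inverse (s n) ^ d) \<longlonglongrightarrow> 0"
        using \<open>d > 0\<close> by (simp add: zero_power)
      then show ?thesis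
        using xP by (intro lim_null_mult_left_bounded[where B = K]) auto
    qed
    have ev: "\<forall>\<^sub>F n in sequentially. s n \<noteq> 0"
      using s_inf filterlim_at_infinity_imp_eventually_ne by blast
    have summand: "(\<lambda>n. c \<alpha> * (s n ^ (\<alpha> $ 1) * (x n $ 2) ^ (\<alpha> $ 2)) * inverse (s n) ^ d)
        \<longlonglongrightarrow> (if deg \<alpha> = d then c \<alpha> * \<mu> ^ (\<alpha> $ 2) else 0)" if "\<alpha> \<in> A" for \<alpha>
    proof -
      have "(\<lambda>n. c \<alpha> * (\<mu> + t n * inverse (s n)) ^ (\<alpha> $ 2) * inverse (s n) ^ (d - deg \<alpha>))
          \<longlonglongrightarrow> c \<alpha> * (\<mu> + 0) ^ (\<alpha> $ 2) * 0 ^ (d - deg \<alpha>)"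
        by (intro tendsto_intros t0 inv0)
      moreover have "c \<alpha> * (\<mu> + 0) ^ (\<alpha> $ 2) * 0 ^ (d - deg \<alpha>)
          = (if deg \<alpha> = d then c \<alpha> * \<mu> ^ (\<alpha> $ 2) else 0)"
        using deg_le[OF that] by auto
      moreover have "\<forall>\<^sub>F n in sequentially.
          c \<alpha> * (\<mu> + t n * inverse (s n)) ^ (\<alpha> $ 2) * inverse (s n) ^ (d - deg \<alpha>)
          = c \<alpha> * (s n ^ (\<alpha> $ 1) * (x n $ 2) ^ (\<alpha> $ 2)) * inverse (s n) ^ d"
        using ev
      proof eventually_elim
        case (elim n)
        have "x n $ 2 = s n * (\<mu> + t n * inverse (s n))"
          using elim by (simp add: x2 field_simps)
        then have "s n ^ (\<alpha> $ 1) * (x n $ 2) ^ (\<alpha> $ 2)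
            = s n ^ deg \<alpha> * (\<mu> + t n * inverse (s n)) ^ (\<alpha> $ 2)"
          by (simp add: power_mult_distrib power_add deg_def)
        moreover have "inverse (s n) ^ d = inverse (s n) ^ deg \<alpha> * inverse (s n) ^ (d - deg \<alpha>)"
          using deg_le[OF that] by (simp flip: power_add)
        moreover have "s n ^ deg \<alpha> * inverse (s n) ^ deg \<alpha> = 1"
          using elim by (simp flip: power_mult_distrib)
        ultimately show ?case by (simp add: algebra_simps)
      qed
      ultimately show ?thesis by (simp add: tendsto_cong)
    qed
    have "(\<lambda>n. \<Sum>\<alpha>\<in>A. c \<alpha> * (s n ^ (\<alpha> $ 1) * (x n $ 2) ^ (\<alpha> $ 2)) * inverse (s n) ^ d)
        \<longlonglongrightarrow> (\<Sum>\<alpha>\<in>A. if deg \<alpha> = d then c \<alpha> * \<mu> ^ (\<alpha> $ 2) else 0)"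
      by (intro tendsto_sum summand)
    moreover have "(\<Sum>\<alpha>\<in>A. if deg \<alpha> = d then c \<alpha> * \<mu> ^ (\<alpha> $ 2) else 0) = poly q \<mu>"
      using \<open>finite A\<close> by (simp add: q_def poly_sum poly_monom sum.inter_filter[symmetric])
    moreover have "(\<Sum>\<alpha>\<in>A. c \<alpha> * (s n ^ (\<alpha> $ 1) * (x n $ 2) ^ (\<alpha> $ 2)) * inverse (s n) ^ d)
        = P (x n) * inverse (s n) ^ d" for n
      by (simp add: P s_def sum_distrib_right)
    ultimately have "(\<lambda>n. P (x n) * inverse (s n) ^ d) \<longlonglongrightarrow> poly q \<mu>" by simp
    with p0 have "poly q \<mu> = 0" by (rule LIMSEQ_unique[symmetric])
    with \<mu> show False by simp
  qed
  with that show thesis by blast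
qed

section \<open>The polynomial hull and the closed convex hull\<close>

lemma holomorphic_polynomial_affine:
  "holomorphic_polynomial (\<lambda>z :: complex ^ 'n. b + (\<Sum>i\<in>UNIV. a i * z $ i))"
proof -
  define e :: "'n \<Rightarrow> nat ^ 'n" where "e = (\<lambda>i. axis i 1)"
  have inj: "inj e" by (auto simp: e_def inj_on_def axis_eq_axis)
  have e0: "e i \<noteq> 0" for i by (simp add: e_def axis_eq_0_iff)
  define c where "c = (\<lambda>\<alpha>. if \<alpha> = 0 then b else a (the_inv e \<alpha>))"
  have mono: "(\<Prod>j\<in>UNIV. (z $ j) ^ (e i $ j)) = z $ i" for z :: "complex ^ 'n" and i
  proof -
    have "(\<Prod>j\<in>UNIV. (z $ j) ^ (e i $ j)) = (\<Prod>j\<in>UNIV. if j = i then z $ j else 1)"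
      by (intro prod.cong) (auto simp: e_def axis_def)
    then show ?thesis by simp
  qed
  have "b + (\<Sum>i\<in>UNIV. a i * z $ i)
      = (\<Sum>\<alpha>\<in>insert 0 (range e). c \<alpha> * (\<Prod>j\<in>UNIV. (z $ j) ^ (\<alpha> $ j)))" for z :: "complex ^ 'n"
  proof -
    have "0 \<notin> range e" using e0 by (metis rangeE)
    then show ?thesis
      using inj e0 by (simp add: sum.reindex mono c_def the_inv_f_f)
  qed
  then show ?thesis
    unfolding holomorphic_polynomial_def
    by (intro exI[of _ "insert 0 (range e)"] exI[of _ c]) auto
qed

lemma holomorphic_polynomial_comp:
  assumes "holomorphic_map_on f S" "holomorphic_polynomial P"
  shows "(\<lambda>\<zeta>. P (f \<zeta>)) holomorphic_on S"
proof -
  obtain A :: "(nat ^ 'a) set" and c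
    where P: "P = (\<lambda>z. \<Sum>\<alpha>\<in>A. c \<alpha> * (\<Prod>i\<in>UNIV. (z $ i) ^ (\<alpha> $ i)))"
    using assms(2) unfolding holomorphic_polynomial_def by blast
  show ?thesis
    unfolding P using assms(1) unfolding holomorphic_map_on_def
    by (intro holomorphic_intros) auto
qed

lemma proper_on_discD:
  assumes "proper_on_disc f"
  obtains \<rho> where "\<rho> < 1" "\<And>z. \<lbrakk>\<rho> < cmod z; cmod z < 1\<rbrakk> \<Longrightarrow> norm (f z) > R"
proof -
  have "\<forall>\<^sub>F z in filtercomap cmod (at_left 1). norm (f z) > R"
    using assms unfolding proper_on_disc_def filterlim_at_top_dense by blast
  then obtain Q where Q: "\<forall>\<^sub>F x in at_left 1. Q x" "\<And>z. Q (cmod z) \<Longrightarrow> norm (f z) > R"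
    unfolding eventually_filtercomap by blast
  obtain \<rho> where "\<rho> < 1" "\<And>x. \<lbrakk>\<rho> < x; x < 1\<rbrakk> \<Longrightarrow> Q x"
    using Q(1) eventually_at_left[of 0 "1::real"] by auto
  with Q(2) that show thesis by blast
qed

lemma polynomial_hull_proper_disc_arc:
  fixes f :: "complex \<Rightarrow> complex ^ 2"
  assumes hol: "holomorphic_map_on f (ball 0 1)" and proper: "proper_on_disc f"
    and "open D" and p: "p \<in> D" "cmod p = 1"
  shows "polynomial_hull (f ` (ball 0 1 \<inter> D)) = UNIV"
proof -
  have "Re (P z) \<le> 0"
    if P: "holomorphic_polynomial P" and le: "f ` (ball 0 1 \<inter> D) \<subseteq> {z. Re (P z) \<le> 0}" for P z
  proof (cases "\<exists>a. P = (\<lambda>_. a)")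
    case True
    have "p \<in> closure (ball 0 1)" using p by (simp add: closure_ball)
    then obtain w where "w \<in> ball 0 1 \<inter> D"
      using \<open>open D\<close> p(1) unfolding closure_iff_nhds_not_empty by blast
    moreover obtain a where "P = (\<lambda>_. a)" using True by blast
    ultimately show ?thesis using le by blast
  next
    case False
    then obtain \<mu> where \<mu>: "\<And>K. \<exists>R. \<forall>z. cmod (P z) \<le> K \<longrightarrow> cmod (z $ 2 - \<mu> * z $ 1) \<le> K \<longrightarrow> norm z \<le> R"
      using nonconstant_polynomial_proper_with_linear[OF P] by metis
    have "False"
    proof (rule half_plane_valued_pair_not_proper_at_arc[OF \<open>open D\<close> p])
      show "(\<lambda>\<zeta>. f \<zeta> $ 2 - \<mu> * f \<zeta> $ 1) holomorphic_on ball 0 1 \<inter> D"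
        using hol unfolding holomorphic_map_on_def
        by (intro holomorphic_intros) (auto intro: holomorphic_on_subset)
      show "(\<lambda>\<zeta>. P (f \<zeta>)) holomorphic_on ball 0 1 \<inter> D"
        using holomorphic_polynomial_comp[OF hol P] by (auto intro: holomorphic_on_subset)
      show "Re (P (f \<zeta>)) \<le> 0" if "\<zeta> \<in> ball 0 1 \<inter> D" for \<zeta>
        using le that by blast
      fix K
      obtain R where R: "\<And>z. \<lbrakk>cmod (P z) \<le> K; cmod (z $ 2 - \<mu> * z $ 1) \<le> K\<rbrakk> \<Longrightarrow> norm z \<le> R"
        using \<mu> by meson
      obtain \<rho> where "\<rho> < 1" "\<And>z. \<lbrakk>\<rho> < cmod z; cmod z < 1\<rbrakk> \<Longrightarrow> norm (f z) > R"
        using proper_on_discD[OF proper] by metis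
      with R show "\<exists>\<rho><1. \<forall>z\<in>ball 0 1 \<inter> D. cmod z > \<rho> \<longrightarrow>
          cmod (f z $ 2 - \<mu> * f z $ 1) > K \<or> cmod (P (f z)) > K"
        by (intro exI[of _ \<rho>]) (force simp: not_le[symmetric])
    qed
    then show ?thesis ..
  qed
  then show ?thesis unfolding polynomial_hull_def by blast
qed

text \<open>
  A point outside the closed convex hull is separated from it by a real affine function, and
  every such function on \<open>\<complex>\<^sup>n\<close> is the real part of a polynomial of degree at most 1.
\<close>
lemma polynomial_hull_subset_closed_convex_hull:
  "polynomial_hull K \<subseteq> closure (convex hull K)"
proof
  fix y assume y: "y \<in> polynomial_hull K"
  show "y \<in> closure (convex hull K)"
  proof (rule ccontr)
    assume "y \<notin> closure (convex hull K)"
    then obtain a b where ab: "inner a y < b" "\<And>x. x \<in> closure (convex hull K) \<Longrightarrow> inner a x > b"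
      using separating_hyperplane_closed_point[of "closure (convex hull K)" y]
      by (auto simp: convex_closure)
    define P where "P = (\<lambda>z. of_real b + (\<Sum>i\<in>UNIV. - cnj (a $ i) * z $ i))"
    have Re_P: "Re (P z) = b - inner a z" for z
      by (simp add: P_def inner_vec_def inner_complex_def sum_negf sum.distrib)
    have "K \<subseteq> {z. Re (P z) \<le> 0}"
    proof
      fix x assume "x \<in> K"
      then have "x \<in> closure (convex hull K)"
        by (intro subsetD[OF closure_subset] hull_inc)
      then show "x \<in> {z. Re (P z) \<le> 0}" using ab(2) by (force simp: Re_P)
    qed
    moreover have "holomorphic_polynomial P"
      unfolding P_def by (rule holomorphic_polynomial_affine)
    ultimately have "Re (P y) \<le> 0"
      using y unfolding polynomial_hull_def by blast
    with ab(1) show False by (simp add: Re_P)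
  qed
qed

theorem corollary1p6:
  fixes f :: "complex \<Rightarrow> complex ^ 2" and D :: "complex set"
  assumes "holomorphic_map_on f (ball 0 1)"
    and "proper_on_disc f"
    and "open D"
    and "D \<inter> sphere 0 1 \<noteq> {}"
  shows "polynomial_hull (f ` (ball 0 1 \<inter> D)) = UNIV
     \<and> closure (convex hull (f ` (ball 0 1 \<inter> D))) = UNIV"
proof -
  obtain p where p: "p \<in> D" "cmod p = 1"
    using assms(4) by auto
  have "polynomial_hull (f ` (ball 0 1 \<inter> D)) = UNIV"
    using polynomial_hull_proper_disc_arc[OF assms(1-3) p] .
  with polynomial_hull_subset_closed_convex_hull[of "f ` (ball 0 1 \<inter> D)"] show ?thesis
    by blast
qed

end
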